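(* For every real $s\ge 0$ there exists a finite set $\mathcal{S}_s$ of low-defect pairs such that: (1) for every $n\in B_s$ there is some low-defect pair in $\mathcal{S}_s$ that efficiently $3$-represents $n$; (2) every pair $(f,C)\in\mathcal{S}_s$ satisfies $\delta(f,C)\le s$, hence $\deg f\le\lfloor s\rfloor$; and if $f$ has degree $0$, then $\delta(f,C)<s$.
   Context: For $n\in\mathbb{N}$, $\|n\|$ (the complexity of $n$) is the least number of $1$'s needed to write $n$ using $1$, $+$, $\times$ and parentheses; the defect is $\delta(n)=\|n\|-3\log_3 n$. A natural number $n$ is a leader if it is the smallest natural number having defect $\delta(n)$; equivalently, either $3\nmid n$, or $3\mid n$ and $\delta(n)<\delta(n/3)$. $B_s$ denotes the set of leaders $n$ with $\delta(n)<s$. Low-defect pairs: the set of low-defect pairs is the smallest subset of $\mathbb{Z}[x_1,x_2,\ldots]\times\mathbb{N}$ such that: (i) for any constant $k\in\mathbb{N}$ and any $C\ge\|k\|$, $(k,C)$ is a low-defect pair; (ii) if $(f_1,C_1)$, $(f_2,C_2)$ are low-defect pairs with $f_1$ in $r_1$ variables and $f_2$ in $r_2$ variables, then $(f_1\otimes f_2, C_1+C_2)$ is a low-defect pair, where $(f_1\otimes f_2)(x_1,\ldots,x_{r_1+r_2})=f_1(x_1,\ldots,x_{r_1})f_2(x_{r_1+1},\ldots,x_{r_1+r_2})$; (iii) if $(f,C)$ is a low-defect pair, $c\in\mathbb{N}$ and $D\ge\|c\|$, then $(f\otimes x_1+c, C+D)$ is a low-defect pair (i.e. multiply $f$ by a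 new variable not occurring in $f$ and add $c$). The first coordinates are low-defect polynomials; such a polynomial of degree $r$ is multilinear in $r$ variables with nonnegative integer coefficients, and its leading coefficient (the coefficient of $x_1\cdots x_r$) is nonzero. The degree of a pair means the degree of $f$. The defect of a low-defect pair is $\delta(f,C)=C-3\log_3 a$, where $a$ is the leading coefficient of $f$. A low-defect pair $(f,C)$ of degree $r$ efficiently $3$-represents $N$ if there are nonnegative integers $n_1,\ldots,n_r$ with $N=f(3^{n_1},\ldots,3^{n_r})$ and $\|N\|=C+3(n_1+\cdots+n_r)$. *)

theory Defs
  imports Complex_Main "HOL-Library.Poly_Mapping"
begin

text \<open>Natural numbers in the sense of integer complexity are positive; since the type \<open>nat\<close>
  contains 0, positivity is stated explicitly wherever a number is required to have a complexity.\<close>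

datatype expr = One | Plus expr expr | Times expr expr

primrec expr_value :: "expr \<Rightarrow> nat" where
  "expr_value One = 1"
| "expr_value (Plus a b) = expr_value a + expr_value b"
| "expr_value (Times a b) = expr_value a * expr_value b"

primrec expr_ones :: "expr \<Rightarrow> nat" where
  "expr_ones One = 1"
| "expr_ones (Plus a b) = expr_ones a + expr_ones b"
| "expr_ones (Times a b) = expr_ones a + expr_ones b"

text \<open>Meaningful only for positive arguments: no expression has value 0.\<close>

definition complexity :: "nat \<Rightarrow> nat" where
  "complexity n = (LEAST k. \<exists>e. expr_value e = n \<and> expr_ones e = k)"

definition defect :: "nat \<Rightarrow> real" where
  "defect n = real (complexity n) - 3 * log 3 (real n)"

definition leader :: "nat \<Rightarrow> bool" where
  "leader n \<longleftrightarrow> n > 0 \<and> (\<forall>m>0. defect m = defect n \<longrightarrow> n \<le> m)"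

definition B :: "real \<Rightarrow> nat set" where
  "B s = {n. leader n \<and> defect n < s}"

text \<open>A polynomial in \<open>\<int>[x\<^sub>1, x\<^sub>2, \<dots>]\<close> is a finitely supported map from monomials to coefficients,
  a monomial being a finitely supported map from variable indices to exponents. Indices start
  at 0, so index \<open>i\<close> stands for the variable usually written \<open>x\<close> with subscript \<open>i + 1\<close>.\<close>

type_synonym ipoly = "(nat \<Rightarrow>\<^sub>0 nat) \<Rightarrow>\<^sub>0 int"

definition pvar :: "nat \<Rightarrow> ipoly" where
  "pvar i = Poly_Mapping.single (Poly_Mapping.single i 1) 1"

text \<open>Substitution of elements of an arbitrary commutative ring for the variables; it is used both
  for numerical evaluation and for renaming variables.\<close>

definition peval :: "(nat \<Rightarrow> 'a::comm_ring_1) \<Rightarrow> ipoly \<Rightarrow> 'a" where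
  "peval x f = (\<Sum>m\<in>Poly_Mapping.keys f. of_int (Poly_Mapping.lookup f m) *
     (\<Prod>i\<in>Poly_Mapping.keys m. x i ^ Poly_Mapping.lookup m i))"

definition pvars :: "ipoly \<Rightarrow> nat set" where
  "pvars f = (\<Union>m\<in>Poly_Mapping.keys f. Poly_Mapping.keys m)"

text \<open>The least \<open>r\<close> such that \<open>f\<close> lies in the polynomial ring in the first \<open>r\<close> variables.\<close>

definition nvars :: "ipoly \<Rightarrow> nat" where
  "nvars f = (LEAST r. pvars f \<subseteq> {..<r})"

definition pdegree :: "ipoly \<Rightarrow> nat" where
  "pdegree f = Max (insert 0 ((\<lambda>m. \<Sum>i\<in>Poly_Mapping.keys m. Poly_Mapping.lookup m i) `
     Poly_Mapping.keys f))"

definition ptensor :: "ipoly \<Rightarrow> ipoly \<Rightarrow> ipoly"  (infixl "\<otimes>\<^sub>p" 70) where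
  "f \<otimes>\<^sub>p g = f * peval (\<lambda>i. pvar (nvars f + i)) g"

inductive_set low_defect_pairs :: "(ipoly \<times> nat) set" where
  const: "k > 0 \<Longrightarrow> C \<ge> complexity k \<Longrightarrow> (of_nat k, C) \<in> low_defect_pairs"
| tensor: "(f\<^sub>1, C\<^sub>1) \<in> low_defect_pairs \<Longrightarrow> (f\<^sub>2, C\<^sub>2) \<in> low_defect_pairs \<Longrightarrow>
    (f\<^sub>1 \<otimes>\<^sub>p f\<^sub>2, C\<^sub>1 + C\<^sub>2) \<in> low_defect_pairs"
| extend: "(f, C) \<in> low_defect_pairs \<Longrightarrow> c > 0 \<Longrightarrow> D \<ge> complexity c \<Longrightarrow>
    (f \<otimes>\<^sub>p pvar 0 + of_nat c, C + D) \<in> low_defect_pairs"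

text \<open>For a low-defect polynomial of degree \<open>r\<close> the leading coefficient is that of the product
  of the first \<open>r\<close> variables.\<close>

definition ldp_lead_coeff :: "ipoly \<Rightarrow> int" where
  "ldp_lead_coeff f =
     Poly_Mapping.lookup f (\<Sum>i<pdegree f. Poly_Mapping.single i 1)"

definition pair_defect :: "ipoly \<times> nat \<Rightarrow> real" where
  "pair_defect = (\<lambda>(f, C). real C - 3 * log 3 (real_of_int (ldp_lead_coeff f)))"

text \<open>Only the values \<open>e i\<close> with \<open>i < pdegree f\<close> matter, since a low-defect polynomial of degree
  \<open>r\<close> involves exactly the first \<open>r\<close> variables.\<close>

definition efficiently_3_represents :: "ipoly \<times> nat \<Rightarrow> nat \<Rightarrow> bool" where
  "efficiently_3_represents = (\<lambda>(f, C) N. \<exists>e :: nat \<Rightarrow> nat.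
     int N = peval (\<lambda>i. 3 ^ e i) f \<and> complexity N = C + 3 * (\<Sum>i<pdegree f. e i))"

end

theory Submission
  imports Defs
begin

text \<open>Call a set of pairs spanning below \<open>s\<close> if every \<open>n\<close> with defect less than \<open>s\<close> is a power
  of 3 times an efficiently represented number, with additive complexities. Spanning sets exist by
  induction on \<open>s\<close> in steps of 1/10: an optimal expression for \<open>n > 3\<close> is a sum \<open>a + b\<close> with
  \<open>b \<le> a\<close>, and then \<open>a\<close> has defect smaller by at least 1/10 while the complexity of \<open>b\<close> is bounded,
  or it is a product \<open>a b\<close>, and then either both defects drop by 1/10 or one factor has defect less
  than 1/10 and is a power of 3.

  To enforce the bound on the defects of the pairs, observe that if all variables lying deepest in
  the construction of \<open>f\<close> take large values, then \<open>f\<close> is close to its leading term and the defect of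
  the represented number is close to that of the pair. So when the latter exceeds \<open>s\<close>, a number of
  defect less than \<open>s\<close> has one of its deepest variables equal to one of finitely many powers of 3;
  substituting that value gives a low-defect pair of smaller degree.\<close>

section \<open>Evaluation of polynomials\<close>

text \<open>Every finitely supported map is the sum of its one-point parts. The zero map has no case
  of its own: it is a one-point map with value 0.\<close>

lemma single_plus_induct [case_names single add]:
  fixes f :: "'a \<Rightarrow>\<^sub>0 'b::comm_monoid_add"
  assumes single: "\<And>m c. P (Poly_Mapping.single m c)"
    and add: "\<And>f g. P f \<Longrightarrow> P g \<Longrightarrow> P (f + g)"
  shows "P f"
proof -
  have "f = (\<Sum>m\<in>Poly_Mapping.keys f. Poly_Mapping.single m (Poly_Mapping.lookup f m))"
    by (rule poly_mapping_eqI) (simp add: lookup_sum lookup_single when_def in_keys_iff)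
  moreover have "P (\<Sum>m\<in>M. Poly_Mapping.single m (Poly_Mapping.lookup f m))" if "finite M" for M
    using that
  proof (induction M rule: finite_induct)
    case empty
    show ?case using single[of _ 0] by simp
  next
    case (insert m M)
    then show ?case using add single by simp
  qed
  ultimately show ?thesis by (metis finite_keys)
qed

definition mono_eval :: "(nat \<Rightarrow> 'a::comm_ring_1) \<Rightarrow> (nat \<Rightarrow>\<^sub>0 nat) \<Rightarrow> 'a" where
  "mono_eval x m = (\<Prod>i\<in>Poly_Mapping.keys m. x i ^ Poly_Mapping.lookup m i)"

text \<open>Indices outside the support contribute the factor \<open>x i ^ 0\<close>, so monomials
  with different supports can be evaluated over a common index set.\<close>

lemma mono_eval_superset:
  assumes "finite A" "Poly_Mapping.keys m \<subseteq> A"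
  shows "mono_eval x m = (\<Prod>i\<in>A. x i ^ Poly_Mapping.lookup m i)"
  unfolding mono_eval_def
  by (rule prod.mono_neutral_left) (use assms in \<open>auto simp: in_keys_iff\<close>)

lemma mono_eval_0 [simp]: "mono_eval x 0 = 1"
  by (simp add: mono_eval_def)

lemma mono_eval_add: "mono_eval x (m + n) = mono_eval x m * mono_eval x n"
proof -
  let ?A = "Poly_Mapping.keys m \<union> Poly_Mapping.keys n"
  have "mono_eval x k = (\<Prod>i\<in>?A. x i ^ Poly_Mapping.lookup k i)" if "k \<in> {m, n, m + n}" for k
    by (rule mono_eval_superset) (use that keys_add[of m n] in auto)
  then show ?thesis
    by (simp add: lookup_add power_add prod.distrib)
qed

lemma peval_single: "peval x (Poly_Mapping.single m c) = of_int c * mono_eval x m"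
  by (simp add: peval_def mono_eval_def)

lemma peval_add: "peval x (f + g) = peval x f + peval x g"
  unfolding peval_def by (rule setsum_keys_plus_distrib) (simp_all add: distrib_right)

lemma peval_mult: "peval x (f * g) = peval x f * peval x g"
proof (induction f rule: single_plus_induct)
  case (single m c)
  show ?case
    by (induction g rule: single_plus_induct)
      (simp_all add: mult_single peval_single mono_eval_add peval_add algebra_simps)
next
  case (add f g)
  then show ?case by (simp add: peval_add algebra_simps)
qed

lemma peval_of_int [simp]: "peval x (of_int c) = of_int c"
  using peval_single[of x 0 c] by (simp flip: single_of_int)

lemma peval_of_nat [simp]: "peval x (of_nat c) = of_nat c"
  using peval_of_int[of x "int c"] by simp

lemma peval_pvar [simp]: "peval x (pvar i) = x i"
  by (simp add: pvar_def peval_single mono_eval_def)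

lemma peval_power: "peval x (f ^ k) = peval x f ^ k"
  by (induction k) (use peval_of_nat[of x 1] in \<open>simp_all add: peval_mult\<close>)

lemma peval_prod: "peval x (\<Prod>i\<in>A. f i) = (\<Prod>i\<in>A. peval x (f i))"
  by (induction A rule: infinite_finite_induct)
    (use peval_of_nat[of x 1] in \<open>simp_all add: peval_mult\<close>)

text \<open>Turns evaluation of a polynomial with renamed variables into evaluation at a shifted
  assignment, as the second factor of \<open>ptensor\<close> requires.\<close>

lemma peval_peval: "peval x (peval y f) = peval (\<lambda>i. peval x (y i)) f"
  by (induction f rule: single_plus_induct)
    (simp_all add: peval_single peval_add peval_mult mono_eval_def peval_prod peval_power)

lemma peval_tensor: "peval x (f \<otimes>\<^sub>p g) = peval x f * peval (\<lambda>i. x (nvars f + i)) g"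
  by (simp add: ptensor_def peval_mult peval_peval)

section \<open>Multilinear leading terms\<close>

text \<open>Squarefree monomials are encoded by sets of variables; \<open>sqfree_mono {..<d}\<close>
  is the monomial inspected by \<open>ldp_lead_coeff\<close> in degree \<open>d\<close>.\<close>

definition sqfree_mono :: "nat set \<Rightarrow> (nat \<Rightarrow>\<^sub>0 nat)" where
  "sqfree_mono A = (\<Sum>i\<in>A. Poly_Mapping.single i 1)"

lemma lookup_sqfree_mono: "finite A \<Longrightarrow> Poly_Mapping.lookup (sqfree_mono A) i = (if i \<in> A then 1 else 0)"
  by (simp add: sqfree_mono_def lookup_sum lookup_single when_def)

lemma keys_sqfree_mono: "finite A \<Longrightarrow> Poly_Mapping.keys (sqfree_mono A) = A"
  by (auto simp: in_keys_iff lookup_sqfree_mono split: if_splits)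

lemma sqfree_mono_empty [simp]: "sqfree_mono {} = 0"
  by (simp add: sqfree_mono_def)

lemma sqfree_mono_union:
  "finite A \<Longrightarrow> finite C \<Longrightarrow> A \<inter> C = {} \<Longrightarrow> sqfree_mono (A \<union> C) = sqfree_mono A + sqfree_mono C"
  by (simp add: sqfree_mono_def sum.union_disjoint)

lemma mono_eval_shift:
  assumes "finite A"
  shows "mono_eval (\<lambda>i. pvar (r + i)) (sqfree_mono A) = Poly_Mapping.single (sqfree_mono ((+) r ` A)) 1"
proof -
  have "(\<Prod>i\<in>A. pvar (r + i)) = Poly_Mapping.single (sqfree_mono ((+) r ` A)) 1"
    using assms
  proof (induction A rule: finite_induct)
    case (insert a A)
    then have "sqfree_mono ((+) r ` insert a A) = Poly_Mapping.single (r + a) 1 + sqfree_mono ((+) r ` A)"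
      by (subst image_insert, unfold sqfree_mono_def, subst sum.insert) auto
    with insert show ?case by (simp add: pvar_def mult_single)
  qed simp
  then show ?thesis
    using assms by (simp add: mono_eval_def keys_sqfree_mono lookup_sqfree_mono)
qed

text \<open>Strict inclusion keeps the full monomial out of \<open>f\<close>, so that adding
  \<open>f\<close> to a leading term cannot disturb the leading coefficient.\<close>

definition sqfree_below :: "nat \<Rightarrow> ipoly \<Rightarrow> bool" where
  "sqfree_below d f \<longleftrightarrow> (\<forall>m\<in>Poly_Mapping.keys f. \<exists>A. A \<subset> {..<d} \<and> m = sqfree_mono A)"

definition multilinear_lead :: "nat \<Rightarrow> int \<Rightarrow> ipoly \<Rightarrow> bool" where
  "multilinear_lead d a f \<longleftrightarrow>
     (\<exists>g. sqfree_below d g \<and> f = Poly_Mapping.single (sqfree_mono {..<d}) a + g)"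

lemma sqfree_below_add: "sqfree_below d f \<Longrightarrow> sqfree_below d g \<Longrightarrow> sqfree_below d (f + g)"
  unfolding sqfree_below_def using keys_add[of f g] by blast

text \<open>Over two disjoint blocks of variables, the full monomial arises only as the product of
  the full monomials of both blocks.\<close>

lemma psubset_lessThan_Un_shift:
  fixes d e :: nat
  assumes "A \<subseteq> {..<d}" "C \<subseteq> {..<e}" "A \<noteq> {..<d} \<or> C \<noteq> {..<e}"
  shows "A \<union> (+) d ` C \<subset> {..<d + e}"
proof -
  have "A \<union> (+) d ` C \<subseteq> {..<d + e}" using assms(1,2) by fastforce
  moreover have "A \<union> (+) d ` C \<noteq> {..<d + e}"
  proof
    assume eq: "A \<union> (+) d ` C = {..<d + e}"
    have "i \<in> A" if "i < d" for i
    proof -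
      have "i \<in> A \<union> (+) d ` C" using eq that by auto
      then show ?thesis using that by auto
    qed
    moreover have "i \<in> C" if "i < e" for i
    proof -
      have "d + i \<in> A \<union> (+) d ` C" using eq that by auto
      then show ?thesis using assms(1) by auto
    qed
    ultimately show False using assms by auto
  qed
  ultimately show ?thesis by blast
qed

text \<open>Renaming takes each squarefree term to one squarefree term, and a sum has no monomials
  beyond those of its summands.\<close>

lemma keys_shift_sqfree:
  assumes "\<And>m. m \<in> Poly_Mapping.keys f \<Longrightarrow> \<exists>A. A \<in> \<A> \<and> finite A \<and> m = sqfree_mono A"
    and "m \<in> Poly_Mapping.keys (peval (\<lambda>i. pvar (r + i)) f)"
  shows "\<exists>A. A \<in> \<A> \<and> m = sqfree_mono ((+) r ` A)"
proof -
  have eq: "peval (\<lambda>i. pvar (r + i)) f =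
      (\<Sum>m\<in>Poly_Mapping.keys f. of_int (Poly_Mapping.lookup f m) * mono_eval (\<lambda>i. pvar (r + i)) m)"
    by (simp add: peval_def mono_eval_def)
  then obtain k where k: "k \<in> Poly_Mapping.keys f"
    and m: "m \<in> Poly_Mapping.keys (of_int (Poly_Mapping.lookup f k) * mono_eval (\<lambda>i. pvar (r + i)) k :: ipoly)"
    using assms(2) keys_sum unfolding eq by (metis (no_types, lifting) UN_E subsetD)
  from assms(1)[OF k] obtain A where A: "A \<in> \<A>" "finite A" "k = sqfree_mono A" by blast
  have "(of_int (Poly_Mapping.lookup f k) * mono_eval (\<lambda>i. pvar (r + i)) k :: ipoly) =
     Poly_Mapping.single (sqfree_mono ((+) r ` A)) (Poly_Mapping.lookup f k)"
    unfolding A(3) mono_eval_shift[OF A(2)] by (simp add: mult_single flip: single_of_int)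
  with m A show ?thesis by (auto split: if_splits)
qed

text \<open>The families bound which monomials occur in each factor; \<open>ne\<close> excludes the
  one combination that would give the full monomial.\<close>

lemma sqfree_below_mult_shift:
  assumes f: "\<And>m. m \<in> Poly_Mapping.keys f \<Longrightarrow> \<exists>A. A \<in> \<A> \<and> m = sqfree_mono A"
    and g: "\<And>m. m \<in> Poly_Mapping.keys g \<Longrightarrow> \<exists>A. A \<in> \<C> \<and> m = sqfree_mono A"
    and sub: "\<And>A. A \<in> \<A> \<Longrightarrow> A \<subseteq> {..<d}" "\<And>C. C \<in> \<C> \<Longrightarrow> C \<subseteq> {..<e}"
    and ne: "{..<d} \<notin> \<A> \<or> {..<e} \<notin> \<C>"
  shows "sqfree_below (d + e) (f * peval (\<lambda>i. pvar (d + i)) g)"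
  unfolding sqfree_below_def
proof
  fix m assume "m \<in> Poly_Mapping.keys (f * peval (\<lambda>i. pvar (d + i)) g)"
  then obtain a b where ab: "m = a + b" "a \<in> Poly_Mapping.keys f"
    "b \<in> Poly_Mapping.keys (peval (\<lambda>i. pvar (d + i)) g)"
    using keys_mult by blast
  obtain A where A: "A \<in> \<A>" "a = sqfree_mono A" using f ab by blast
  have fin: "finite A" "\<And>C. C \<in> \<C> \<Longrightarrow> finite C"
    using sub A finite_subset[OF _ finite_lessThan] by blast+
  have "\<exists>C. C \<in> \<C> \<and> b = sqfree_mono ((+) d ` C)"
    by (rule keys_shift_sqfree[OF _ ab(3)]) (use g fin in blast)
  then obtain C where C: "C \<in> \<C>" "b = sqfree_mono ((+) d ` C)" by blast
  have "A \<inter> (+) d ` C = {}" using sub A by fastforce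
  then have "m = sqfree_mono (A \<union> (+) d ` C)"
    using ab A C fin by (simp add: sqfree_mono_union)
  moreover have "A \<union> (+) d ` C \<subset> {..<d + e}"
    using psubset_lessThan_Un_shift sub A C ne by metis
  ultimately show "\<exists>A. A \<subset> {..<d + e} \<and> m = sqfree_mono A" by blast
qed

text \<open>When the product is expanded, the two leading terms give the new leading term. Every
  other product has a proper subset of variables on one side and so stays below it.\<close>

lemma multilinear_lead_mult_shift:
  assumes "multilinear_lead d a f" "multilinear_lead e b g"
  shows "multilinear_lead (d + e) (a * b) (f * peval (\<lambda>i. pvar (d + i)) g)"
proof -
  let ?S = "peval (\<lambda>i. pvar (d + i)) :: ipoly \<Rightarrow> ipoly"
  let ?s = "Poly_Mapping.single (sqfree_mono {..<d}) a"
  let ?t = "Poly_Mapping.single (sqfree_mono {..<e}) b"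
  obtain f' g' where f': "sqfree_below d f'" "f = ?s + f'" and g': "sqfree_below e g'" "g = ?t + g'"
    using assms unfolding multilinear_lead_def by blast
  have shift: "(+) d ` {..<e} = {d..<d + e}"
    by (simp add: lessThan_atLeast0 add.commute)
  have un: "sqfree_mono {..<d} + sqfree_mono {d..<d + e} = sqfree_mono {..<d + e}"
    using sqfree_mono_union[of "{..<d}" "{d..<d + e}"] ivl_disj_un_one(2)[of d "d + e"]
      ivl_disj_int_one(2)[of d "d + e"] by simp
  have "?S ?t = of_int b * mono_eval (\<lambda>i. pvar (d + i)) (sqfree_mono {..<e})"
    by (rule peval_single)
  also have "\<dots> = Poly_Mapping.single (sqfree_mono {d..<d + e}) b"
    unfolding mono_eval_shift[OF finite_lessThan] shift by (simp add: mult_single flip: single_of_int)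
  finally have "?s * ?S ?t = Poly_Mapping.single (sqfree_mono {..<d + e}) (a * b)"
    by (simp only: mult_single un)
  moreover have "f * ?S g = ?s * ?S g + f' * ?S g"
    unfolding f'(2) by (rule distrib_right)
  moreover have "?s * ?S g = ?s * ?S ?t + ?s * ?S g'"
    unfolding g'(2) peval_add by (rule distrib_left)
  ultimately have eq: "f * ?S g = Poly_Mapping.single (sqfree_mono {..<d + e}) (a * b) + ?s * ?S g' + f' * ?S g"
    by simp
  have g: "\<exists>A. A \<in> {A. A \<subseteq> {..<e}} \<and> m = sqfree_mono A" if "m \<in> Poly_Mapping.keys g" for m
  proof -
    have "m \<in> Poly_Mapping.keys ?t \<union> Poly_Mapping.keys g'" 
      using that unfolding g'(2) by (rule subsetD[OF keys_add])
    then consider "m = sqfree_mono {..<e}" | "m \<in> Poly_Mapping.keys g'"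
      by (auto split: if_splits)
    then show ?thesis using g'(1) unfolding sqfree_below_def by cases blast+
  qed
  have s_keys: "Poly_Mapping.keys ?s \<subseteq> {sqfree_mono {..<d}}"
    by simp
  have "sqfree_below (d + e) (?s * ?S g')"
    by (rule sqfree_below_mult_shift[where \<A>="{{..<d}}" and \<C>="{A. A \<subset> {..<e}}"])
      (use g'(1) s_keys in \<open>auto simp: sqfree_below_def\<close>)
  moreover have "sqfree_below (d + e) (f' * ?S g)"
  proof (rule sqfree_below_mult_shift)
    show "\<exists>A. A \<in> {A. A \<subset> {..<d}} \<and> m = sqfree_mono A" if "m \<in> Poly_Mapping.keys f'" for m
      using f'(1) that unfolding sqfree_below_def by blast
  qed (use g in auto)
  ultimately have "sqfree_below (d + e) (?s * ?S g' + f' * ?S g)"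
    by (rule sqfree_below_add)
  then show ?thesis
    unfolding multilinear_lead_def by (intro exI conjI) (assumption, simp only: eq add.assoc)
qed

lemma multilinear_lead_of_nat: "multilinear_lead 0 (int k) (of_nat k)"
  unfolding multilinear_lead_def sqfree_below_def
  by (intro exI[of _ 0]) (simp flip: single_of_nat)

lemma multilinear_lead_pvar: "multilinear_lead 1 1 (pvar 0)"
  unfolding multilinear_lead_def sqfree_below_def
  by (intro exI[of _ 0]) (simp add: pvar_def sqfree_mono_def)

text \<open>A constant belongs to the empty set of variables, a proper subset of
  \<open>{..<Suc d}\<close>; in degree 0 it could change the leading coefficient.\<close>

lemma multilinear_lead_add_const:
  assumes "multilinear_lead (Suc d) a f"
  shows "multilinear_lead (Suc d) a (f + of_nat c)"
proof -
  have "sqfree_below (Suc d) (of_nat c)"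
    unfolding sqfree_below_def by (auto simp flip: single_of_nat intro!: exI[of _ "{}"])
  with assms sqfree_below_add show ?thesis
    unfolding multilinear_lead_def by (metis add.assoc)
qed

section \<open>Number of variables, degree and leading coefficient read off from the shape\<close>

context
  fixes d a f
  assumes ml: "multilinear_lead d a f" and a: "a \<noteq> 0"
begin

text \<open>A squarefree monomial determines its set of variables, so the full monomial does not
  occur in the remainder.\<close>

lemma lookup_sqfree_lead: "Poly_Mapping.lookup f (sqfree_mono {..<d}) = a"
proof -
  obtain g where g: "sqfree_below d g" "f = Poly_Mapping.single (sqfree_mono {..<d}) a + g"
    using ml unfolding multilinear_lead_def by blast
  have "sqfree_mono {..<d} \<notin> Poly_Mapping.keys g"
  proof
    assume "sqfree_mono {..<d} \<in> Poly_Mapping.keys g"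
    then obtain A where A: "A \<subset> {..<d}" "sqfree_mono {..<d} = sqfree_mono A"
      using g(1) unfolding sqfree_below_def by blast
    then have "finite A" by (meson finite_lessThan finite_subset psubset_imp_subset)
    with A keys_sqfree_mono show False by (metis finite_lessThan psubset_eq)
  qed
  then show ?thesis by (simp add: g(2) lookup_add in_keys_iff)
qed

lemma multilinear_keys:
  assumes "m \<in> Poly_Mapping.keys f"
  obtains A where "A \<subseteq> {..<d}" "m = sqfree_mono A"
proof -
  obtain g where g: "sqfree_below d g" "f = Poly_Mapping.single (sqfree_mono {..<d}) a + g"
    using ml unfolding multilinear_lead_def by blast
  have "m \<in> insert (sqfree_mono {..<d}) (Poly_Mapping.keys g)"
    using assms g(2) keys_add[of "Poly_Mapping.single (sqfree_mono {..<d}) a" g] by (auto split: if_splits)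
  with g(1) that show ?thesis unfolding sqfree_below_def by blast
qed

lemma lead_in_keys: "sqfree_mono {..<d} \<in> Poly_Mapping.keys f"
  using lookup_sqfree_lead a by (simp add: in_keys_iff)

lemma nvars_multilinear: "nvars f = d"
proof -
  have "pvars f = {..<d}"
  proof
    show "pvars f \<subseteq> {..<d}"
      unfolding pvars_def
      by (auto elim!: multilinear_keys)
        (metis finite_lessThan finite_subset keys_sqfree_mono lessThan_iff subsetD)
    show "{..<d} \<subseteq> pvars f"
      unfolding pvars_def using lead_in_keys keys_sqfree_mono[of "{..<d}"] by blast
  qed
  then show ?thesis
    unfolding nvars_def by (intro Least_equality) auto
qed

text \<open>The monomial of a set \<open>A\<close> has total degree \<open>card A\<close>, which is
  largest for the full set.\<close>

lemma pdegree_multilinear: "pdegree f = d"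
proof -
  have deg: "(\<Sum>i\<in>Poly_Mapping.keys (sqfree_mono A). Poly_Mapping.lookup (sqfree_mono A) i) = card A"
    if "A \<subseteq> {..<d}" for A
    using finite_subset[OF that] by (simp add: keys_sqfree_mono lookup_sqfree_mono)
  show ?thesis
    unfolding pdegree_def
  proof (rule Max_eqI)
    fix y assume "y \<in> insert 0 ((\<lambda>m. \<Sum>i\<in>Poly_Mapping.keys m. Poly_Mapping.lookup m i) ` Poly_Mapping.keys f)"
    then consider "y = 0" | m where "m \<in> Poly_Mapping.keys f"
      "y = (\<Sum>i\<in>Poly_Mapping.keys m. Poly_Mapping.lookup m i)" by blast
    then show "y \<le> d"
    proof cases
      case 2
      then obtain A where A: "A \<subseteq> {..<d}" "m = sqfree_mono A" using multilinear_keys by blast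
      then show ?thesis using 2 deg card_mono[of "{..<d}" A] by simp
    qed simp
  qed (use lead_in_keys deg[of "{..<d}"] in \<open>auto simp: image_iff intro!: bexI\<close>)
qed

lemma ldp_lead_coeff_multilinear: "ldp_lead_coeff f = a"
  using lookup_sqfree_lead by (simp add: ldp_lead_coeff_def pdegree_multilinear sqfree_mono_def)

end

section \<open>Complexity and defect\<close>

lemma expr_value_pos: "expr_value e > 0"
  by (induction e) auto

lemma expr_ones_pos: "expr_ones e > 0"
  by (induction e) auto

lemma ex_expr_value: "n > 0 \<Longrightarrow> \<exists>e. expr_value e = n"
proof (induction n rule: nat_induct_non_zero)
  case 1
  show ?case by (rule exI[of _ One]) simp
next
  case (Suc n)
  then obtain e where "expr_value e = n" by blast
  then show ?case by (intro exI[of _ "Plus e One"]) simp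
qed

lemma complexity_le: "complexity (expr_value e) \<le> expr_ones e"
  unfolding complexity_def by (rule Least_le) blast

lemma optimal_expr:
  assumes "n > 0"
  obtains e where "expr_value e = n" "expr_ones e = complexity n"
proof -
  from ex_expr_value[OF assms] have "\<exists>k e. expr_value e = n \<and> expr_ones e = k" by blast
  from LeastI_ex[OF this] show ?thesis using that unfolding complexity_def by blast
qed

lemma complexity_pos: "n > 0 \<Longrightarrow> complexity n > 0"
  by (metis optimal_expr expr_ones_pos)

lemma complexity_1 [simp]: "complexity (Suc 0) = 1"
  using complexity_le[of One] complexity_pos[of 1] by simp

lemma complexity_add_le: "a > 0 \<Longrightarrow> b > 0 \<Longrightarrow> complexity (a + b) \<le> complexity a + complexity b"
  by (metis optimal_expr complexity_le expr_value.simps(2) expr_ones.simps(2))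

lemma complexity_mult_le: "a > 0 \<Longrightarrow> b > 0 \<Longrightarrow> complexity (a * b) \<le> complexity a + complexity b"
  by (metis optimal_expr complexity_le expr_value.simps(3) expr_ones.simps(3))

text \<open>The cases are the root operations of an optimal expression. Subadditivity forces both
  subexpressions to be optimal, and a factor 1 would waste a one.\<close>

lemma complexity_cases:
  assumes "n > 0"
  obtains "n = 1"
  | a b where "0 < b" "b \<le> a" "n = a + b" "complexity n = complexity a + complexity b"
  | a b where "2 \<le> a" "2 \<le> b" "n = a * b" "complexity n = complexity a + complexity b"
proof -
  obtain e where e: "expr_value e = n" "expr_ones e = complexity n" using optimal_expr[OF assms] .
  show ?thesis
  proof (cases e)
    case One
    then show ?thesis using e that(1) by simp
  next
    case (Plus u v)
    let ?a = "expr_value u" and ?b = "expr_value v"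
    have "complexity n = complexity ?a + complexity ?b"
      using e Plus complexity_le[of u] complexity_le[of v]
        complexity_add_le[OF expr_value_pos expr_value_pos, of u v] by auto
    then show ?thesis
      using that(2)[of ?b ?a] that(2)[of ?a ?b] e(1) Plus expr_value_pos[of u] expr_value_pos[of v]
      by (cases "?b \<le> ?a") (auto simp: add.commute)
  next
    case (Times u v)
    let ?a = "expr_value u" and ?b = "expr_value v"
    have c: "complexity n = complexity ?a + complexity ?b"
      using e Times complexity_le[of u] complexity_le[of v]
        complexity_mult_le[OF expr_value_pos expr_value_pos, of u v] by auto
    have n: "n = ?a * ?b" using e Times by simp
    have "?a \<noteq> 1" "?b \<noteq> 1"
      using c n complexity_pos[OF expr_value_pos, of u] complexity_pos[OF expr_value_pos, of v] by auto
    then show ?thesis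
      using that(3)[OF _ _ n c] expr_value_pos[of u] expr_value_pos[of v] by linarith
  qed
qed

lemma complexity_ge_2:
  assumes "n \<ge> 2"
  shows "complexity n \<ge> 2"
proof -
  have "n > 0" using assms by simp
  then show ?thesis
  proof (cases rule: complexity_cases)
    case 1
    then show ?thesis using assms by simp
  next
    case (2 a b)
    then show ?thesis using complexity_pos[of a] complexity_pos[of b] by simp
  next
    case (3 a b)
    then show ?thesis using complexity_pos[of a] complexity_pos[of b] by simp
  qed
qed

section \<open>Growth of the defect under addition and multiplication\<close>

lemma log_3_2_bound: "3 * log 3 2 \<le> (19/10 :: real)"
proof -
  have "30 * log 3 2 = log 3 ((2::real) ^ 30)" by (subst log_nat_power) simp_all
  \<comment> \<open>Here \<open>2 ^ 30 \<le> 3 ^ 19\<close>. A bound below 2 makes every summand of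
    complexity at least 2 raise the defect.\<close>
  also have "\<dots> \<le> log 3 (3 ^ 19)" by (subst log_le_cancel_iff) simp_all
  also have "\<dots> = (19::real)" by (subst log_nat_power) simp_all
  finally show ?thesis by simp
qed

lemma log_3_4_3_bound: "3 * log 3 (4/3) \<le> (9/10 :: real)"
proof -
  have "10 * log 3 (4/3) = log 3 ((4/3::real) ^ 10)" by (subst log_nat_power) simp_all
  \<comment> \<open>Here \<open>(4/3) ^ 10 \<le> 27\<close>. A bound below 1 settles the summand 1,
    of complexity 1.\<close>
  also have "\<dots> \<le> log 3 (3 ^ 3)" by (subst log_le_cancel_iff) (simp_all add: power_divide)
  also have "\<dots> = (3::real)" by (subst log_nat_power) simp_all
  finally show ?thesis by simp
qed

lemma defect_add:
  assumes "0 < b" "b \<le> a" "complexity (a + b) = complexity a + complexity b"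
  shows "defect (a + b) \<ge> defect a + complexity b - 19/10"
proof -
  have "log 3 (real (a + b)) \<le> log 3 (2 * real a)"
    using assms by (subst log_le_cancel_iff) simp_all
  also have "\<dots> = log 3 2 + log 3 (real a)" using assms by (subst log_mult) simp_all
  finally show ?thesis using assms(3) log_3_2_bound by (simp add: defect_def)
qed

text \<open>If \<open>b = 1\<close>, then \<open>a \<ge> 3\<close> and the sum is at most
  \<open>4/3 * a\<close>; otherwise \<open>b\<close> has complexity at least 2. The sum 3 = 2 + 1 is
  a true exception: 3 has defect 0 and 2 has positive defect.\<close>

lemma defect_add_gap:
  assumes "0 < b" "b \<le> a" "complexity (a + b) = complexity a + complexity b" "a + b > 3"
  shows "defect (a + b) \<ge> defect a + 1/10"
proof (cases "b = 1")
  case False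
  then have "complexity b \<ge> 2" using assms complexity_ge_2[of b] by simp
  then show ?thesis using defect_add[OF assms(1-3)] by simp
next
  case True
  have "log 3 (real (a + b)) \<le> log 3 (4/3 * real a)"
    using assms True by (subst log_le_cancel_iff) simp_all
  also have "\<dots> = log 3 (4/3) + log 3 (real a)" using assms by (subst log_mult) simp_all
  finally show ?thesis using assms(3) log_3_4_3_bound True by (simp add: defect_def)
qed

lemma defect_mult:
  assumes "a > 0" "b > 0" "complexity (a * b) = complexity a + complexity b"
  shows "defect (a * b) = defect a + defect b"
  using assms by (simp add: defect_def log_mult)

lemma defect_2: "defect 2 \<ge> 1/10"
  using complexity_ge_2[of 2] log_3_2_bound by (simp add: defect_def)

lemma complexity_3: "complexity 3 = 3"
proof -
  have "3 > (0::nat)" by simp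
  then have "complexity 3 \<ge> 3"
  proof (cases rule: complexity_cases)
    case (2 a b)
    then have ab: "a = 2" "b = 1" by linarith+
    show ?thesis using complexity_ge_2[of 2] unfolding 2(4) ab by simp
  next
    case (3 a b)
    then have "2 * 2 \<le> a * b" by (intro mult_le_mono)
    then show ?thesis using 3 by simp
  qed simp
  moreover have "complexity 3 \<le> 3" 
    using complexity_add_le[of 2 1] complexity_add_le[of 1 1, unfolded one_add_one] by simp
  ultimately show ?thesis by simp
qed

text \<open>Beyond 3, an optimal sum has larger defect than its larger summand, and the defect of an
  optimal product is the sum of the defects.\<close>

lemma defect_nonneg: "n > 0 \<Longrightarrow> defect n \<ge> 0"
proof (induction n rule: less_induct)
  case (less n)
  consider "n = 1" | "n = 2" | "n = 3" | "n > 3" using less.prems by linarith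
  then show ?case
  proof cases
    case 4
    from less.prems show ?thesis
    proof (cases rule: complexity_cases)
      case (2 a b)
      then show ?thesis using defect_add_gap[of b a] less.IH[of a] 4 by simp
    next
      case (3 a b)
      then show ?thesis using defect_mult[of a b] less.IH[of a] less.IH[of b] by simp
    qed (use 4 in simp)
  next
    case 2
    then show ?thesis using defect_2 by simp
  qed (simp_all add: defect_def complexity_3)
qed

lemma log_le_complexity: "n > 0 \<Longrightarrow> 3 * log 3 (real n) \<le> real (complexity n)"
  using defect_nonneg by (simp add: defect_def)

lemma finite_complexity_le: "finite {n. 0 < n \<and> complexity n \<le> K}"
proof (rule finite_subset)
  show "{n. 0 < n \<and> complexity n \<le> K} \<subseteq> {..3 ^ K}"
  proof
    fix n assume "n \<in> {n. 0 < n \<and> complexity n \<le> K}"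
    then have n: "0 < n" "complexity n \<le> K" by simp_all
    \<comment> \<open>Since the logarithm is nonnegative, the factor 3 in front of it may be
      dropped, which leaves the integral exponent \<open>K\<close> in place of
      \<open>K / 3\<close>.\<close>
    then have "0 \<le> log 3 (real n)" by simp
    then have "log 3 (real n) \<le> real K" using log_le_complexity[OF n(1)] n(2) by linarith
    then have "real n \<le> 3 powr real K" using n(1) by (simp add: log_le_iff)
    then have "real n \<le> real (3 ^ K)" by (simp add: powr_realpow)
    then show "n \<in> {..3 ^ K}" by (simp only: of_nat_le_iff atMost_iff)
  qed
qed simp

text \<open>Beyond 3, an optimal sum has defect at least 1/10, so \<open>n\<close> is an optimal
  product of factors that again have small defect. The exponent is positive because 1 has defect
  1.\<close>

lemma small_defect_power_3:
  assumes "n > 0" "defect n < 1/10"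
  obtains k where "n = 3 ^ Suc k"
proof -
  have "\<exists>k. n = 3 ^ Suc k"
    using assms
  proof (induction n rule: less_induct)
    case (less n)
    consider "n = 1" | "n = 2" | "n = 3" | "n > 3" using less.prems by linarith
    then show ?case
    proof cases
      case 3
      then show ?thesis by (intro exI[of _ 0]) simp
    next
      case 4
      from less.prems(1) show ?thesis
      proof (cases rule: complexity_cases)
        case (2 a b)
        then show ?thesis using defect_add_gap[of b a] defect_nonneg[of a] 4 less.prems by simp
      next
        case (3 a b)
        then have "defect n = defect a + defect b" using defect_mult[of a b] by simp
        then have "defect a < 1/10" "defect b < 1/10"
          using less.prems defect_nonneg[of a] defect_nonneg[of b] 3 by simp_all
        then obtain k l where "a = 3 ^ Suc k" "b = 3 ^ Suc l"
          using less.IH[of a] less.IH[of b] 3 by auto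
        then show ?thesis using 3 by (intro exI[of _ "k + l + 1"]) (simp add: power_add)
      qed (use 4 in simp)
    next
      case 1
      then show ?thesis using less.prems by (simp add: defect_def)
    next
      case 2
      then show ?thesis using less.prems defect_2 by simp
    qed
  qed
  with that show ?thesis by blast
qed

lemma complexity_mult_power_3_le: "n > 0 \<Longrightarrow> complexity (n * 3 ^ k) \<le> complexity n + 3 * k"
proof (induction k)
  case (Suc k)
  then show ?case
    using complexity_mult_le[of "n * 3 ^ k" 3] complexity_3 by (simp add: ac_simps)
qed simp

text \<open>The lower bound comes from \<open>log_le_complexity\<close>. Exponent 0 is excluded
  because 1 has complexity 1.\<close>

lemma complexity_power_3: "complexity (3 ^ Suc k) = 3 * Suc k"
proof -
  have "3 * log 3 (real (3 ^ Suc k)) = real (3 * Suc k)"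
    by (simp add: log_nat_power del: power_Suc)
  then have "complexity (3 ^ Suc k) \<ge> 3 * Suc k"
    using log_le_complexity[of "3 ^ Suc k"] by (simp del: power_Suc)
  moreover have "complexity (3 ^ Suc k) \<le> 3 * Suc k"
    using complexity_mult_power_3_le[of 3 k] complexity_3 by simp
  ultimately show ?thesis by simp
qed

section \<open>Construction trees of low-defect pairs\<close>

text \<open>The construction is recorded rather than the polynomial, so that degree, cost and values
  are defined by recursion. Only \<open>Const\<close> carries its own cost: a constant that arises
  by substituting for a variable may cost more than its complexity.\<close>

datatype ldtree = Const nat nat | Tensor ldtree ldtree | Extend ldtree nat

primrec admissible :: "ldtree \<Rightarrow> bool" where
  "admissible (Const k C) \<longleftrightarrow> k > 0 \<and> C \<ge> complexity k"
| "admissible (Tensor t u) \<longleftrightarrow> admissible t \<and> admissible u"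
| "admissible (Extend t c) \<longleftrightarrow> admissible t \<and> c > 0"

primrec tdegree :: "ldtree \<Rightarrow> nat" where
  "tdegree (Const k C) = 0"
| "tdegree (Tensor t u) = tdegree t + tdegree u"
| "tdegree (Extend t c) = Suc (tdegree t)"

primrec cost :: "ldtree \<Rightarrow> nat" where
  "cost (Const k C) = C"
| "cost (Tensor t u) = cost t + cost u"
| "cost (Extend t c) = cost t + complexity c"

primrec lead :: "ldtree \<Rightarrow> nat" where
  "lead (Const k C) = k"
| "lead (Tensor t u) = lead t * lead u"
| "lead (Extend t c) = lead t"

text \<open>Pairs of a value at powers of 3 and the sum of the exponents.\<close>

primrec reps :: "ldtree \<Rightarrow> (nat \<times> nat) set" where
  "reps (Const k C) = {(k, 0)}"
| "reps (Tensor t u) = {(M * N, D + E) | M N D E. (M, D) \<in> reps t \<and> (N, E) \<in> reps u}"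
| "reps (Extend t c) = {(N * 3 ^ j + c, E + j) | N E j. (N, E) \<in> reps t}"

definition tdefect :: "ldtree \<Rightarrow> real" where
  "tdefect t = real (cost t) - 3 * log 3 (real (lead t))"

lemma lead_pos: "admissible t \<Longrightarrow> lead t > 0"
  by (induction t) auto

text \<open>Each \<open>Extend\<close> keeps the leading coefficient and raises the cost by at least
  1.\<close>

lemma complexity_lead_le: "admissible t \<Longrightarrow> complexity (lead t) + tdegree t \<le> cost t"
proof (induction t)
  case (Tensor t u)
  then show ?case using complexity_mult_le[of "lead t" "lead u"] lead_pos[of t] lead_pos[of u] by simp
next
  case (Extend t c)
  then show ?case using complexity_pos[of c] by simp
qed simp

lemma tdegree_le_tdefect:
  assumes "admissible t"
  shows "tdegree t \<le> tdefect t"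
  using complexity_lead_le[OF assms] log_le_complexity[OF lead_pos[OF assms]]
  unfolding tdefect_def by linarith

lemma reps_tdegree_0: "tdegree t = 0 \<Longrightarrow> reps t = {(lead t, 0)}"
  by (induction t) auto

text \<open>Dropping every added constant leaves the value of the leading term.\<close>

lemma reps_lower: "(N, E) \<in> reps t \<Longrightarrow> lead t * 3 ^ E \<le> N"
proof (induction t arbitrary: N E)
  case (Tensor t u)
  then obtain M K D F where *: "N = M * K" "E = D + F" "(M, D) \<in> reps t" "(K, F) \<in> reps u" by auto
  then have "(lead t * 3 ^ D) * (lead u * 3 ^ F) \<le> M * K"
    using Tensor.IH by (intro mult_le_mono) auto
  then show ?case using * by (simp add: power_add ac_simps)
next
  case (Extend t c)
  then obtain M D j where *: "N = M * 3 ^ j + c" "E = D + j" "(M, D) \<in> reps t" by auto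
  then have "lead t * 3 ^ D * 3 ^ j \<le> M * 3 ^ j" using Extend.IH by simp
  then have "lead t * 3 ^ E \<le> M * 3 ^ j" using *(2) by (simp add: power_add mult.assoc)
  then show ?case using *(1) by simp
qed simp

lemma reps_pos: "admissible t \<Longrightarrow> (N, E) \<in> reps t \<Longrightarrow> N > 0"
  using reps_lower lead_pos by (meson less_le_trans nat_0_less_mult_iff zero_less_numeral zero_less_power)

text \<open>Following the construction yields an expression for \<open>N\<close> in which each
  factor 3 costs three ones.\<close>

lemma complexity_reps_le: "admissible t \<Longrightarrow> (N, E) \<in> reps t \<Longrightarrow> complexity N \<le> cost t + 3 * E"
proof (induction t arbitrary: N E)
  case (Tensor t u)
  then obtain M K D F where *: "N = M * K" "E = D + F" "(M, D) \<in> reps t" "(K, F) \<in> reps u" by auto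
  then have "complexity M \<le> cost t + 3 * D" "complexity K \<le> cost u + 3 * F"
    using Tensor by auto
  moreover have "complexity N \<le> complexity M + complexity K"
    unfolding *(1) by (rule complexity_mult_le) (use * Tensor.prems reps_pos in auto)
  ultimately show ?case using * by simp
next
  case (Extend t c)
  then obtain M D j where *: "N = M * 3 ^ j + c" "E = D + j" "(M, D) \<in> reps t" by auto
  then have M: "M > 0" "complexity M \<le> cost t + 3 * D" using Extend reps_pos by auto
  then have "complexity N \<le> complexity (M * 3 ^ j) + complexity c"
    unfolding *(1) using Extend.prems by (intro complexity_add_le) auto
  then show ?case using complexity_mult_power_3_le[OF M(1), of j] M * by simp
qed simp

section \<open>Truncation\<close>

lemma eventually_mult_power_3_ge_1:
  fixes \<epsilon> :: real
  assumes "\<epsilon> > 0"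
  obtains K where "\<And>j. j \<ge> K \<Longrightarrow> 1 \<le> \<epsilon> * 3 ^ j"
proof -
  obtain K where K: "1 / \<epsilon> < 3 ^ K"
    using real_arch_pow[of 3] by auto
  have "1 \<le> \<epsilon> * 3 ^ j" if "j \<ge> K" for j
  proof -
    have "(3::real) ^ K \<le> 3 ^ j" using that by simp
    then have "1 / \<epsilon> \<le> 3 ^ j" using K by linarith
    then show ?thesis using assms by (simp add: field_simps)
  qed
  with that show ?thesis by blast
qed

text \<open>The cost equation transfers efficiency: if \<open>t\<close> represents \<open>N\<close>
  efficiently with exponent sum \<open>E\<close>, then so does \<open>u\<close> with exponent sum
  \<open>D\<close>. The exponent of a fixed variable moves into the cost.\<close>

definition covers :: "ldtree set \<Rightarrow> ldtree \<Rightarrow> nat \<Rightarrow> nat \<Rightarrow> bool" where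
  "covers F t N E \<longleftrightarrow> (\<exists>u\<in>F. \<exists>D. (N, D) \<in> reps u \<and> cost u + 3 * D = cost t + 3 * E)"

text \<open>The second conjunct makes a constant added outside \<open>t\<close> negligible against the leading term.\<close>

definition near_lead :: "real \<Rightarrow> ldtree \<Rightarrow> nat \<Rightarrow> nat \<Rightarrow> bool" where
  "near_lead \<epsilon> t N E \<longleftrightarrow>
     real N \<le> (1 + \<epsilon>) * (lead t * 3 ^ E) \<and> (tdegree t > 0 \<longrightarrow> 1 \<le> \<epsilon> * 3 ^ E)"

text \<open>The trees in \<open>F\<close> arise from \<open>t\<close> by fixing one of its deepest variables.\<close>

definition reduces :: "real \<Rightarrow> ldtree set \<Rightarrow> ldtree \<Rightarrow> bool" where
  "reduces \<epsilon> F t \<longleftrightarrow> finite F \<and> (\<forall>u\<in>F. admissible u \<and> tdegree u < tdegree t) \<and>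
     (\<forall>(N, E)\<in>reps t. covers F t N E \<or> near_lead \<epsilon> t N E)"

text \<open>If either factor is covered, replacing it by its reduced tree covers the product;
  otherwise both factors are near their leading terms and the relative errors multiply.\<close>

lemma reduces_Tensor:
  assumes adm: "admissible t" "admissible u" and \<epsilon>: "0 < \<epsilon>"
    and F: "reduces (min 1 (\<epsilon> / 3)) F t" and G: "reduces (min 1 (\<epsilon> / 3)) G u"
  shows "reduces \<epsilon> ((\<lambda>t'. Tensor t' u) ` F \<union> Tensor t ` G) (Tensor t u)"
proof -
  let ?H = "(\<lambda>t'. Tensor t' u) ` F \<union> Tensor t ` G"
  \<comment> \<open>With \<open>\<delta> \<le> 1\<close>, the product of the two error factors
    \<open>1 + \<delta>\<close> is at most \<open>1 + 3 * \<delta>\<close>.\<close>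
  define \<delta> where "\<delta> = min 1 (\<epsilon> / 3)"
  have \<delta>: "0 < \<delta>" "\<delta> \<le> 1" "3 * \<delta> \<le> \<epsilon>" using \<epsilon> by (auto simp: \<delta>_def)
  have "covers ?H (Tensor t u) N E \<or> near_lead \<epsilon> (Tensor t u) N E"
    if in_reps: "(N, E) \<in> reps (Tensor t u)" for N E
  proof -
    obtain M K D P where *: "N = M * K" "E = D + P" "(M, D) \<in> reps t" "(K, P) \<in> reps u"
      using in_reps by auto
    have "covers F t M D \<or> near_lead \<delta> t M D" "covers G u K P \<or> near_lead \<delta> u K P"
      using F G * unfolding reduces_def \<delta>_def by blast+
    then consider "covers F t M D" | "covers G u K P"
      | "near_lead \<delta> t M D" "near_lead \<delta> u K P" by blast
    then show ?thesis
    proof cases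
      case 1
      then obtain v R where v: "v \<in> F" "(M, R) \<in> reps v" "cost v + 3 * R = cost t + 3 * D"
        unfolding covers_def by blast
      then have "(N, R + P) \<in> reps (Tensor v u)" using * by auto
      moreover have "cost (Tensor v u) + 3 * (R + P) = cost (Tensor t u) + 3 * E" using v * by simp
      ultimately have "covers ?H (Tensor t u) N E" using v(1) unfolding covers_def by blast
      then show ?thesis ..
    next
      case 2
      then obtain v R where v: "v \<in> G" "(K, R) \<in> reps v" "cost v + 3 * R = cost u + 3 * P"
        unfolding covers_def by blast
      then have "(N, D + R) \<in> reps (Tensor t v)" using * by auto
      moreover have "cost (Tensor t v) + 3 * (D + R) = cost (Tensor t u) + 3 * E" using v * by simp
      ultimately have "covers ?H (Tensor t u) N E" using v(1) unfolding covers_def by blast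
      then show ?thesis ..
    next
      case 3
      let ?x = "real (lead t) * 3 ^ D" and ?y = "real (lead u) * 3 ^ P"
      have "real M * real K \<le> ((1 + \<delta>) * ?x) * ((1 + \<delta>) * ?y)"
        using 3 \<delta> by (intro mult_mono) (auto simp: near_lead_def)
      also have "\<dots> = (1 + (2 * \<delta> + \<delta> * \<delta>)) * (?x * ?y)" by (simp add: algebra_simps)
      also have "\<dots> \<le> (1 + \<epsilon>) * (?x * ?y)"
      proof (rule mult_right_mono)
        have "\<delta> * \<delta> \<le> \<delta>" using \<delta> by (simp add: mult_left_le)
        then show "1 + (2 * \<delta> + \<delta> * \<delta>) \<le> 1 + \<epsilon>" using \<delta> by linarith
      qed simp
      finally have "real N \<le> (1 + \<epsilon>) * (lead (Tensor t u) * 3 ^ E)"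
        using * by (simp add: power_add ac_simps)
      moreover have "1 \<le> \<epsilon> * 3 ^ E" if "tdegree (Tensor t u) > 0"
      proof -
        have "1 \<le> \<delta> * 3 ^ D \<or> 1 \<le> \<delta> * 3 ^ P" using that 3 by (auto simp: near_lead_def)
        moreover have "\<delta> * 3 ^ D \<le> \<epsilon> * 3 ^ E" "\<delta> * 3 ^ P \<le> \<epsilon> * 3 ^ E"
          using \<delta> * by (auto intro!: mult_mono)
        ultimately show ?thesis by linarith
      qed
      ultimately show ?thesis by (simp add: near_lead_def)
    qed
  qed
  then show ?thesis
    using F G adm unfolding reduces_def by auto
qed

text \<open>The new variable is itself deepest, and \<open>t\<close> is constant in value. Small
  exponents are fixed one by one, giving constants; for large ones \<open>c\<close> is
  negligible.\<close>

lemma reduces_Extend_degree_0: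
  assumes t: "admissible t" "tdegree t = 0" and "c > 0" and \<epsilon>: "0 < \<epsilon>"
  shows "\<exists>F. reduces \<epsilon> F (Extend t c)"
proof -
  \<comment> \<open>Beyond \<open>K\<close>, \<open>\<epsilon> * 3 ^ j\<close> is at least
    \<open>1 + real c\<close>, which serves both conjuncts of \<open>near_lead\<close>.\<close>
  obtain K where K: "\<And>j. j \<ge> K \<Longrightarrow> 1 \<le> (\<epsilon> / (1 + real c)) * 3 ^ j"
    using eventually_mult_power_3_ge_1[of "\<epsilon> / (1 + real c)"] \<epsilon> by auto
  define F where "F = (\<lambda>j. Const (lead t * 3 ^ j + c) (cost t + complexity c + 3 * j)) ` {..<K}"
  have reps: "reps t = {(lead t, 0)}" using reps_tdegree_0 t by blast
  have "complexity (lead t * 3 ^ j + c) \<le> cost t + complexity c + 3 * j" for j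
    using complexity_reps_le[of "Extend t c" "lead t * 3 ^ j + c" j] assms reps by auto
  then have adm: "admissible u \<and> tdegree u < tdegree (Extend t c)" if "u \<in> F" for u
    using that \<open>c > 0\<close> by (auto simp: F_def)
  have "covers F (Extend t c) N j \<or> near_lead \<epsilon> (Extend t c) N j"
    if "N = lead t * 3 ^ j + c" for N j
  proof (cases "j < K")
    case True
    then have "Const N (cost t + complexity c + 3 * j) \<in> F" using that unfolding F_def by blast
    then have "covers F (Extend t c) N j" unfolding covers_def by (intro bexI exI[of _ 0]) auto
    then show ?thesis ..
  next
    case False
    then have "1 \<le> (\<epsilon> / (1 + real c)) * 3 ^ j" using K by simp
    then have c: "1 + real c \<le> \<epsilon> * 3 ^ j" by (simp add: field_simps)
    have "1 * (\<epsilon> * 3 ^ j) \<le> real (lead t) * (\<epsilon> * 3 ^ j)"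
      using lead_pos[OF t(1)] \<epsilon> by (intro mult_right_mono) simp_all
    then have "real N \<le> (1 + \<epsilon>) * (real (lead t) * 3 ^ j)"
      using c that by (simp add: algebra_simps)
    then show ?thesis using c by (simp add: near_lead_def)
  qed
  with adm reps show ?thesis
    unfolding reduces_def by (intro exI[of _ F]) (auto simp: F_def)
qed

text \<open>The deepest variables lie inside \<open>t\<close>, and the new variable stays free. If
  \<open>t\<close> is near its leading term, then \<open>1 \<le> \<delta> * 3 ^ E\<close> also
  bounds the relative error caused by \<open>c\<close>.\<close>

lemma reduces_Extend:
  assumes t: "admissible t" "tdegree t > 0" and "c > 0" and \<epsilon>: "0 < \<epsilon>"
    and F: "reduces (\<epsilon> / (1 + real c)) F t"
  shows "reduces \<epsilon> ((\<lambda>u. Extend u c) ` F) (Extend t c)"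
proof -
  let ?H = "(\<lambda>u. Extend u c) ` F"
  \<comment> \<open>The tolerance splits into \<open>\<delta>\<close> for the value of
    \<open>t\<close> and \<open>real c * \<delta>\<close> for the added constant.\<close>
  define \<delta> where "\<delta> = \<epsilon> / (1 + real c)"
  have "\<delta> * (1 + real c) = \<epsilon>" by (simp add: \<delta>_def)
  then have \<delta>: "0 < \<delta>" "\<epsilon> = \<delta> + real c * \<delta>"
    using \<epsilon> by (simp add: \<delta>_def, simp add: algebra_simps)
  have "covers ?H (Extend t c) N E \<or> near_lead \<epsilon> (Extend t c) N E"
    if in_reps: "(N, E) \<in> reps (Extend t c)" for N E
  proof -
    obtain M D j where *: "N = M * 3 ^ j + c" "E = D + j" "(M, D) \<in> reps t"
      using in_reps by auto
    have "covers F t M D \<or> near_lead \<delta> t M D"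
      using F * unfolding reduces_def \<delta>_def by blast
    then show ?thesis
    proof
      assume "covers F t M D"
      then obtain v R where v: "v \<in> F" "(M, R) \<in> reps v" "cost v + 3 * R = cost t + 3 * D"
        unfolding covers_def by blast
      then have "(N, R + j) \<in> reps (Extend v c)" using * by auto
      moreover have "cost (Extend v c) + 3 * (R + j) = cost (Extend t c) + 3 * E" using v * by simp
      ultimately have "covers ?H (Extend t c) N E" using v(1) unfolding covers_def by blast
      then show ?thesis ..
    next
      assume near: "near_lead \<delta> t M D"
      let ?x = "real (lead t) * 3 ^ E"
      have le: "1 \<le> \<delta> * 3 ^ E"
      proof -
        have "1 \<le> \<delta> * 3 ^ D" using near t by (simp add: near_lead_def)
        also have "\<dots> \<le> \<delta> * 3 ^ E" using \<delta> * by (intro mult_left_mono) auto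
        finally show ?thesis .
      qed
      have "1 * (\<delta> * 3 ^ E) \<le> real (lead t) * (\<delta> * 3 ^ E)"
        using lead_pos[OF t(1)] \<delta> by (intro mult_right_mono) simp_all
      then have "1 \<le> \<delta> * ?x" using le by (simp add: ac_simps)
      then have c: "real c * 1 \<le> real c * (\<delta> * ?x)" by (intro mult_left_mono) simp_all
      have "real M * 3 ^ j \<le> ((1 + \<delta>) * (lead t * 3 ^ D)) * 3 ^ j"
        using near by (intro mult_right_mono) (auto simp: near_lead_def)
      also have "\<dots> = (1 + \<delta>) * ?x" using * by (simp add: power_add)
      finally have "real N \<le> (1 + \<delta>) * ?x + real c * (\<delta> * ?x)" using c * by simp
      also have "\<dots> = (1 + \<epsilon>) * ?x" unfolding \<delta>(2) by (simp add: algebra_simps)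
      finally have "real N \<le> (1 + \<epsilon>) * ?x" .
      moreover have "1 \<le> \<epsilon> * 3 ^ E"
      proof -
        have "\<delta> * 3 ^ E \<le> \<epsilon> * 3 ^ E" using \<delta> by (intro mult_right_mono) simp_all
        then show ?thesis using le by linarith
      qed
      ultimately show ?thesis by (simp add: near_lead_def)
    qed
  qed
  then show ?thesis
    using F \<open>c > 0\<close> unfolding reduces_def by auto
qed

lemma ex_reduces:
  assumes "admissible t" "0 < \<epsilon>"
  shows "\<exists>F. reduces \<epsilon> F t"
  using assms
proof (induction t arbitrary: \<epsilon>)
  case (Const k C)
  then show ?case by (intro exI[of _ "{}"]) (simp add: reduces_def near_lead_def)
next
  case (Tensor t u)
  let ?\<delta> = "min 1 (\<epsilon> / 3)"
  have "0 < ?\<delta>" using Tensor.prems by simp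
  then obtain F G where "reduces ?\<delta> F t" "reduces ?\<delta> G u"
    using Tensor.IH[of ?\<delta>] Tensor.prems by auto
  then show ?case using reduces_Tensor[of t u \<epsilon> F G] Tensor.prems by auto
next
  case (Extend t c)
  show ?case
  proof (cases "tdegree t = 0")
    case True
    then show ?thesis using reduces_Extend_degree_0 Extend.prems by simp
  next
    case False
    have pos: "0 < \<epsilon> / (1 + real c)" using Extend.prems by simp
    obtain F where "reduces (\<epsilon> / (1 + real c)) F t"
      using Extend.IH[OF _ pos] Extend.prems by auto
    then show ?thesis using reduces_Extend[of t c \<epsilon> F] False Extend.prems by auto
  qed
qed

section \<open>Replacing a tree by trees of bounded defect\<close>

definition eff_rep :: "ldtree \<Rightarrow> nat \<Rightarrow> bool" where
  "eff_rep t N \<longleftrightarrow> (\<exists>E. (N, E) \<in> reps t \<and> complexity N = cost t + 3 * E)"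

definition truncated :: "real \<Rightarrow> ldtree \<Rightarrow> bool" where
  "truncated s t \<longleftrightarrow> admissible t \<and> tdefect t \<le> s \<and> (tdegree t = 0 \<longrightarrow> tdefect t < s)"

lemma ex_truncation:
  assumes "admissible t"
  shows "\<exists>F. finite F \<and> (\<forall>u\<in>F. truncated s u) \<and>
    (\<forall>N. eff_rep t N \<and> defect N < s \<longrightarrow> (\<exists>u\<in>F. eff_rep u N))"
  using assms
proof (induction "tdegree t" arbitrary: t rule: less_induct)
  case less
  have "truncated s t \<or> (tdegree t = 0 \<and> tdefect t \<ge> s) \<or> (tdegree t > 0 \<and> tdefect t > s)"
    using less.prems by (cases "tdegree t = 0") (auto simp: truncated_def)
  then consider "truncated s t" | "tdegree t = 0 \<and> tdefect t \<ge> s" | "tdegree t > 0 \<and> tdefect t > s"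
    by argo
  then show ?case
  proof cases
    case 1
    then show ?thesis by (intro exI[of _ "{t}"]) simp
  next
    case 2
    \<comment> \<open>In degree 0 the only value is \<open>lead t\<close>, and efficiency makes its
      defect equal to \<open>tdefect t\<close>.\<close>
    have "defect N \<ge> s" if "eff_rep t N" for N
    proof -
      have "N = lead t" "complexity N = cost t"
        using that 2 reps_tdegree_0[of t] unfolding eff_rep_def by auto
      then show ?thesis using 2 by (simp add: defect_def tdefect_def)
    qed
    then have "\<not> (eff_rep t N \<and> defect N < s)" for N
      by (metis not_le)
    then show ?thesis by (intro exI[of _ "{}"]) simp
  next
    case 3
    \<comment> \<open>An error factor \<open>1 + \<epsilon>\<close> lowers the defect by exactly
      \<open>tdefect t - s\<close>, so a number near the leading term still has defect at least
      \<open>s\<close>.\<close>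
    define \<epsilon> where "\<epsilon> = 3 powr ((tdefect t - s) / 3) - 1"
    have "3 powr 0 < (3::real) powr ((tdefect t - s) / 3)"
      using 3 by (subst powr_less_cancel_iff) simp_all
    then have \<epsilon>: "\<epsilon> > 0" by (simp add: \<epsilon>_def)
    have log\<epsilon>: "3 * log 3 (1 + \<epsilon>) = tdefect t - s"
      by (simp add: \<epsilon>_def)
    obtain F where F: "reduces \<epsilon> F t" using ex_reduces[OF less.prems \<epsilon>] by blast
    then have "\<forall>u\<in>F. \<exists>G. finite G \<and> (\<forall>v\<in>G. truncated s v) \<and>
        (\<forall>N. eff_rep u N \<and> defect N < s \<longrightarrow> (\<exists>v\<in>G. eff_rep v N))"
      using less.hyps unfolding reduces_def by blast
    then obtain G where G: "\<And>u. u \<in> F \<Longrightarrow> finite (G u)" "\<And>u v. u \<in> F \<Longrightarrow> v \<in> G u \<Longrightarrow> truncated s v"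
      "\<And>u N. u \<in> F \<Longrightarrow> eff_rep u N \<Longrightarrow> defect N < s \<Longrightarrow> \<exists>v\<in>G u. eff_rep v N"
      by metis
    have "\<exists>v\<in>\<Union> (G ` F). eff_rep v N" if N: "eff_rep t N" "defect N < s" for N
    proof -
      obtain E where E: "(N, E) \<in> reps t" "complexity N = cost t + 3 * E"
        using N unfolding eff_rep_def by blast
      have "\<not> near_lead \<epsilon> t N E"
      proof
        assume "near_lead \<epsilon> t N E"
        then have "real N \<le> (1 + \<epsilon>) * (lead t * 3 ^ E)" by (simp add: near_lead_def)
        then have "log 3 (real N) \<le> log 3 ((1 + \<epsilon>) * (lead t * 3 ^ E))"
          using reps_pos[OF less.prems E(1)] lead_pos[OF less.prems] \<epsilon>
          by (subst log_le_cancel_iff) simp_all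
        also have "\<dots> = log 3 (1 + \<epsilon>) + (log 3 (lead t) + real E)"
          using lead_pos[OF less.prems] \<epsilon> by (simp add: log_mult log_nat_power)
        finally have "defect N \<ge> s"
          using log\<epsilon> E(2) unfolding defect_def tdefect_def by simp
        then show False using N by simp
      qed
      then have "covers F t N E" using F E(1) unfolding reduces_def by blast
      then obtain u where "u \<in> F" "eff_rep u N"
        using E(2) unfolding covers_def eff_rep_def by metis
      then show ?thesis using G(3) N(2) by blast
    qed
    moreover have "finite F" using F by (simp add: reduces_def)
    ultimately show ?thesis
      using G by (intro exI[of _ "\<Union> (G ` F)"]) auto
  qed
qed

section \<open>Spanning sets\<close>

text \<open>The power of 3 is kept outside the tree, since one tree must serve all multiples by
  powers of 3.\<close>

definition rep_up_to_3 :: "ldtree set \<Rightarrow> nat \<Rightarrow> bool" where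
  "rep_up_to_3 S n \<longleftrightarrow> (\<exists>t\<in>S. \<exists>k N E. (N, E) \<in> reps t \<and> n = N * 3 ^ k \<and>
     complexity n = cost t + 3 * E + 3 * k)"

lemma rep_up_to_3_mult_power_3:
  assumes "rep_up_to_3 S a" "complexity (a * 3 ^ l) = complexity a + 3 * l"
  shows "rep_up_to_3 S (a * 3 ^ l)"
proof -
  obtain t k N E where "t \<in> S" "(N, E) \<in> reps t" "a = N * 3 ^ k"
    "complexity a = cost t + 3 * E + 3 * k"
    using assms(1) unfolding rep_up_to_3_def by blast
  then show ?thesis
    unfolding rep_up_to_3_def using assms(2)
    by (intro bexI[of _ t] exI[of _ "k + l"] exI[of _ N] exI[of _ E]) (simp_all add: power_add)
qed

lemma rep_up_to_3_Tensor:
  assumes "rep_up_to_3 S a" "rep_up_to_3 S b" "complexity (a * b) = complexity a + complexity b"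
  shows "rep_up_to_3 (case_prod Tensor ` (S \<times> S)) (a * b)"
proof -
  obtain t k M D where t: "t \<in> S" "(M, D) \<in> reps t" "a = M * 3 ^ k"
    "complexity a = cost t + 3 * D + 3 * k"
    using assms(1) unfolding rep_up_to_3_def by blast
  obtain u l N E where u: "u \<in> S" "(N, E) \<in> reps u" "b = N * 3 ^ l"
    "complexity b = cost u + 3 * E + 3 * l"
    using assms(2) unfolding rep_up_to_3_def by blast
  show ?thesis
    unfolding rep_up_to_3_def
  proof (intro bexI exI conjI)
    show "(M * N, D + E) \<in> reps (Tensor t u)" using t u by auto
    show "a * b = M * N * 3 ^ (k + l)" using t u by (simp add: power_add)
    show "complexity (a * b) = cost (Tensor t u) + 3 * (D + E) + 3 * (k + l)"
      using assms(3) t u by simp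
    show "Tensor t u \<in> case_prod Tensor ` (S \<times> S)" using t u by force
  qed
qed

text \<open>The outer power \<open>3 ^ k\<close> of \<open>a\<close> becomes the value of the new
  variable, so no power remains outside the sum.\<close>

lemma rep_up_to_3_Extend:
  assumes "rep_up_to_3 S a" "b \<in> T" "complexity (a + b) = complexity a + complexity b"
  shows "rep_up_to_3 (case_prod Extend ` (S \<times> T)) (a + b)"
proof -
  obtain t k M D where t: "t \<in> S" "(M, D) \<in> reps t" "a = M * 3 ^ k"
    "complexity a = cost t + 3 * D + 3 * k"
    using assms(1) unfolding rep_up_to_3_def by blast
  show ?thesis
    unfolding rep_up_to_3_def
  proof (intro bexI exI conjI)
    show "(a + b, D + k) \<in> reps (Extend t b)" using t by auto
    show "a + b = (a + b) * 3 ^ 0" by simp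
    show "complexity (a + b) = cost (Extend t b) + 3 * (D + k) + 3 * 0"
      using assms(3) t by simp
    show "Extend t b \<in> case_prod Extend ` (S \<times> T)" using t assms by force
  qed
qed

lemma rep_up_to_3_mono: "rep_up_to_3 S n \<Longrightarrow> S \<subseteq> T \<Longrightarrow> rep_up_to_3 T n"
  unfolding rep_up_to_3_def by blast

definition spans_below :: "ldtree set \<Rightarrow> real \<Rightarrow> bool" where
  "spans_below S s \<longleftrightarrow> finite S \<and> (\<forall>t\<in>S. admissible t) \<and>
     (\<forall>n>0. defect n < s \<longrightarrow> rep_up_to_3 S n)"

text \<open>The constant is 3 and not 1: \<open>3 ^ Suc k\<close> has complexity
  \<open>3 * Suc k\<close>, whereas 1 already has complexity 1.\<close>

lemma spans_below_base: "spans_below {Const 3 3} (1/10)"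
proof -
  have "rep_up_to_3 {Const 3 3} n" if "n > 0" "defect n < 1/10" for n
  proof -
    obtain k where "n = 3 ^ Suc k" using small_defect_power_3[OF \<open>n > 0\<close> \<open>defect n < 1/10\<close>] .
    then show ?thesis
      using complexity_power_3[of k]
      by (auto simp: rep_up_to_3_def intro!: exI[of _ k])
  qed
  then show ?thesis by (simp add: spans_below_def complexity_3)
qed

lemma spans_below_step:
  assumes S: "spans_below S s"
  shows "\<exists>T. spans_below T (s + 1/10)"
proof -
  \<comment> \<open>In an optimal sum, the complexity of the smaller summand is at most the defect
    of the sum plus 19/10, hence less than \<open>s + 1/10 + 19/10\<close>.\<close>
  define P where "P = {b. 0 < b \<and> complexity b \<le> nat \<lceil>s + 2\<rceil>}"
  \<comment> \<open>The constants 1 to 3 cover the range outside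
    \<open>defect_add_gap\<close>.\<close>
  define T where "T = (\<lambda>n. Const n (complexity n)) ` {1..3} \<union>
    case_prod Tensor ` (S \<times> S) \<union> case_prod Extend ` (S \<times> P)"
  have span: "rep_up_to_3 S n" if "n > 0" "defect n < s" for n
    using S that unfolding spans_below_def by blast
  have "rep_up_to_3 T n" if "n > 0" "defect n < s + 1/10" for n
    using that
  proof (induction n rule: less_induct)
    case (less n)
    show ?case
    proof (cases "n \<le> 3")
      case True
      then have "Const n (complexity n) \<in> T" using less.prems by (simp add: T_def)
      then show ?thesis
        unfolding rep_up_to_3_def by (intro bexI exI[of _ 0] exI[of _ n]) auto
    next
      case False
      from less.prems(1) show ?thesis
      proof (cases rule: complexity_cases)
        case (2 a b)
        have "defect a < s" using defect_add_gap[of b a] 2 less.prems False by simp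
        then have a: "rep_up_to_3 S a" using span 2 by simp
        have "real (complexity b) \<le> s + 2"
          using defect_add[of b a] defect_nonneg[of a] 2 less.prems by simp
        then have "b \<in> P" using 2 unfolding P_def by (simp add: le_nat_iff) linarith
        then have "rep_up_to_3 (case_prod Extend ` (S \<times> P)) n"
          using rep_up_to_3_Extend[OF a] 2 by simp
        then show ?thesis by (rule rep_up_to_3_mono) (unfold T_def, blast)
      next
        case (3 a b)
        have d: "defect n = defect a + defect b" using defect_mult[of a b] 3 by simp
        \<comment> \<open>Splitting off a power of 3 need not lower the defect, so \<open>x\<close>
          is handled by the induction on \<open>n\<close>.\<close>
        have small: "rep_up_to_3 T n"
          if *: "n = x * y" "2 \<le> x" "2 \<le> y" "complexity n = complexity x + complexity y"
            "defect n = defect x + defect y" "defect y < 1/10" for x y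
        proof -
          obtain k where k: "y = 3 ^ Suc k" using small_defect_power_3[of y] * by auto
          have "defect x < s + 1/10" using * less.prems defect_nonneg[of y] by simp
          then have "rep_up_to_3 T x" using less.IH[of x] * by simp
          then show ?thesis
            using rep_up_to_3_mult_power_3[of T x "Suc k"] * k complexity_power_3[of k] by simp
        qed
        \<comment> \<open>The defects add up to less than \<open>s + 1/10\<close>, so if neither is
          below 1/10, both are below \<open>s\<close>.\<close>
        consider "defect b < 1/10" | "defect a < 1/10" | "defect a < s" "defect b < s"
          using d less.prems by linarith
        then show ?thesis
        proof cases
          case 1
          then show ?thesis using small[of a b] 3 d by simp
        next
          case 2
          then show ?thesis using small[of b a] 3 d by (simp add: ac_simps)
        next
          case split: 3
          have "rep_up_to_3 (case_prod Tensor ` (S \<times> S)) (a * b)"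
            by (rule rep_up_to_3_Tensor) (use span split 3 in auto)
          then show ?thesis unfolding \<open>n = a * b\<close> by (rule rep_up_to_3_mono) (unfold T_def, blast)
        qed
      qed (use False in simp)
    qed
  qed
  moreover have "finite T"
    using S finite_complexity_le unfolding T_def P_def spans_below_def by blast
  moreover have "admissible t" if "t \<in> T" for t
    using S that unfolding T_def P_def spans_below_def by auto
  ultimately show ?thesis unfolding spans_below_def by blast
qed

lemma ex_spans_below: "\<exists>S. spans_below S s"
proof -
  have step: "\<exists>S. spans_below S (real (Suc i) / 10)" for i
  proof (induction i)
    case 0
    show ?case using spans_below_base by auto
  next
    case (Suc i)
    then obtain S where "spans_below S (real (Suc i) / 10)" by blast
    from spans_below_step[OF this] show ?case by (simp add: field_simps)
  qed
  \<comment> \<open>A set spanning below a larger bound also spans below \<open>s\<close>.\<close>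
  obtain i where "10 * s < real i" using reals_Archimedean2 by blast
  then have "s \<le> real (Suc i) / 10" by simp
  with step[of i] show ?thesis unfolding spans_below_def by force
qed

text \<open>The upper bounds on the complexities of \<open>N\<close> and \<open>N * 3 ^ k\<close>
  must both be sharp. So \<open>N\<close> has the same defect as \<open>n\<close>, and minimality of
  the leader forces \<open>k = 0\<close>.\<close>

lemma leader_eff_rep:
  assumes "leader n" "rep_up_to_3 S n" "\<forall>t\<in>S. admissible t"
  shows "\<exists>t\<in>S. eff_rep t n"
proof -
  obtain t k N E where t: "t \<in> S" "(N, E) \<in> reps t" "n = N * 3 ^ k"
    "complexity n = cost t + 3 * E + 3 * k"
    using assms(2) unfolding rep_up_to_3_def by blast
  have N: "N > 0" using reps_pos t assms(3) by blast
  have "complexity N \<le> cost t + 3 * E" using complexity_reps_le t assms(3) by blast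
  then have "complexity n = complexity N + 3 * k"
    using complexity_mult_power_3_le[OF N, of k] t(4) unfolding t(3) by linarith
  then have "defect N = defect n"
    using N t(3) by (simp add: defect_def log_mult log_nat_power)
  then have "n \<le> N" using assms(1) N unfolding leader_def by blast
  then have "(3::nat) ^ k \<le> 3 ^ 0" using t(3) N by simp
  then have "k = 0" by (subst (asm) power_increasing_iff) simp_all
  then show ?thesis using t unfolding eff_rep_def by auto
qed

section \<open>From trees to polynomials\<close>

primrec poly_of :: "ldtree \<Rightarrow> ipoly" where
  "poly_of (Const k C) = of_nat k"
| "poly_of (Tensor t u) = poly_of t \<otimes>\<^sub>p poly_of u"
| "poly_of (Extend t c) = poly_of t \<otimes>\<^sub>p pvar 0 + of_nat c"

lemma poly_of_low_defect_pair: "admissible t \<Longrightarrow> (poly_of t, cost t) \<in> low_defect_pairs"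
  by (induction t) (auto intro: low_defect_pairs.intros)

text \<open>The shift in \<open>ptensor\<close> is by \<open>nvars\<close>; the induction hypothesis
  for the first factor identifies it with the degree.\<close>

lemma multilinear_lead_poly_of:
  "admissible t \<Longrightarrow> multilinear_lead (tdegree t) (int (lead t)) (poly_of t)"
proof (induction t)
  case (Const k C)
  show ?case using multilinear_lead_of_nat by simp
next
  case (Tensor t u)
  have "nvars (poly_of t) = tdegree t"
    by (rule nvars_multilinear) (use Tensor lead_pos[of t] in auto)
  then show ?case
    using multilinear_lead_mult_shift[of "tdegree t" _ "poly_of t" "tdegree u" _ "poly_of u"] Tensor
    by (simp add: ptensor_def)
next
  case (Extend t c)
  have "nvars (poly_of t) = tdegree t"
    by (rule nvars_multilinear) (use Extend lead_pos[of t] in auto)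
  then have "multilinear_lead (Suc (tdegree t)) (int (lead t)) (poly_of t \<otimes>\<^sub>p pvar 0)"
    using multilinear_lead_mult_shift[OF _ multilinear_lead_pvar, of "tdegree t" _ "poly_of t"] Extend
    by (simp add: ptensor_def)
  then show ?case using multilinear_lead_add_const by simp
qed

lemma
  assumes "admissible t"
  shows nvars_poly_of: "nvars (poly_of t) = tdegree t"
    and pdegree_poly_of: "pdegree (poly_of t) = tdegree t"
    and ldp_lead_coeff_poly_of: "ldp_lead_coeff (poly_of t) = int (lead t)"
  using multilinear_lead_poly_of[OF assms] lead_pos[OF assms]
    nvars_multilinear pdegree_multilinear ldp_lead_coeff_multilinear by auto

lemma pair_defect_poly_of: "admissible t \<Longrightarrow> pair_defect (poly_of t, cost t) = tdefect t"
  by (simp add: pair_defect_def tdefect_def ldp_lead_coeff_poly_of)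

text \<open>Quantifying over all \<open>x\<close> that agree with the powers on the first variables
  lets the induction hypothesis apply to a factor whose assignment continues with the values of
  other variables.\<close>

lemma reps_peval:
  assumes "admissible t" "(N, E) \<in> reps t"
  shows "\<exists>e. \<forall>x :: nat \<Rightarrow> int. (\<forall>i<tdegree t. x i = 3 ^ e i) \<longrightarrow>
    peval x (poly_of t) = int N \<and> (\<Sum>i<tdegree t. e i) = E"
  using assms
proof (induction t arbitrary: N E)
  case (Const k C)
  then show ?case by simp
next
  case (Tensor t u)
  then obtain M K D F where *: "N = M * K" "E = D + F" "(M, D) \<in> reps t" "(K, F) \<in> reps u" by auto
  let ?d = "tdegree t"
  obtain e where e: "\<And>x :: nat \<Rightarrow> int. \<forall>i<?d. x i = 3 ^ e i \<Longrightarrow>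
    peval x (poly_of t) = int M \<and> (\<Sum>i<?d. e i) = D"
    using Tensor.IH(1)[OF _ *(3)] Tensor.prems by auto
  obtain e' where e': "\<And>x :: nat \<Rightarrow> int. \<forall>i<tdegree u. x i = 3 ^ e' i \<Longrightarrow>
    peval x (poly_of u) = int K \<and> (\<Sum>i<tdegree u. e' i) = F"
    using Tensor.IH(2)[OF _ *(4)] Tensor.prems by auto
  \<comment> \<open>The exponents of the second factor follow those of the first, matching the shift
    of its variables.\<close>
  define g where "g i = (if i < ?d then e i else e' (i - ?d))" for i
  have "peval x (poly_of (Tensor t u)) = int N" if x: "\<forall>i<?d + tdegree u. x i = 3 ^ g i"
    for x :: "nat \<Rightarrow> int"
  proof -
    have "peval x (poly_of t) = int M" using e[of x] x by (simp add: g_def)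
    moreover have "peval (\<lambda>i. x (?d + i)) (poly_of u) = int K"
      using e'[of "\<lambda>i. x (?d + i)"] x by (simp add: g_def)
    ultimately show ?thesis
      using Tensor.prems * by (simp add: peval_tensor nvars_poly_of)
  qed
  moreover have "(\<Sum>i<?d + k. g i) = (\<Sum>i<?d. e i) + (\<Sum>i<k. e' i)" for k
    by (induction k) (simp_all add: g_def)
  ultimately show ?case
    using e[of "\<lambda>i. 3 ^ e i"] e'[of "\<lambda>i. 3 ^ e' i"] * by (intro exI[of _ g]) simp
next
  case (Extend t c)
  then obtain M D j where *: "N = M * 3 ^ j + c" "E = D + j" "(M, D) \<in> reps t" by auto
  let ?d = "tdegree t"
  obtain e where e: "\<And>x :: nat \<Rightarrow> int. \<forall>i<?d. x i = 3 ^ e i \<Longrightarrow>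
    peval x (poly_of t) = int M \<and> (\<Sum>i<?d. e i) = D"
    using Extend.IH[OF _ *(3)] Extend.prems by auto
  have "peval x (poly_of (Extend t c)) = int N" if x: "\<forall>i<Suc ?d. x i = 3 ^ (e(?d := j)) i"
    for x :: "nat \<Rightarrow> int"
  \<comment> \<open>The variable introduced by \<open>Extend\<close> has index \<open>?d\<close>,
    and its value is \<open>3 ^ j\<close>.\<close>
  proof -
    have "peval x (poly_of t) = int M" using e[of x] x by simp
    then show ?thesis
      using Extend.prems * x by (simp add: peval_tensor peval_add nvars_poly_of)
  qed
  then show ?case
    using e[of "\<lambda>i. 3 ^ e i"] * by (intro exI[of _ "e(?d := j)"]) simp
qed

lemma efficiently_3_represents_poly_of:
  assumes "admissible t" "eff_rep t N"
  shows "efficiently_3_represents (poly_of t, cost t) N"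
proof -
  obtain E where E: "(N, E) \<in> reps t" "complexity N = cost t + 3 * E"
    using assms(2) unfolding eff_rep_def by blast
  obtain e where e: "\<And>x :: nat \<Rightarrow> int. \<forall>i<tdegree t. x i = 3 ^ e i \<Longrightarrow>
    peval x (poly_of t) = int N \<and> (\<Sum>i<tdegree t. e i) = E"
    using reps_peval[OF assms(1) E(1)] by blast
  from e[of "\<lambda>i. 3 ^ e i"] show ?thesis
    unfolding efficiently_3_represents_def using E(2) pdegree_poly_of[OF assms(1)]
    by (auto intro!: exI[of _ e])
qed

theorem theorem4p9:
  fixes s :: real
  assumes "s \<ge> 0"
  shows "\<exists>S. finite S \<and> S \<subseteq> low_defect_pairs \<and>
    (\<forall>n\<in>B s. \<exists>p\<in>S. efficiently_3_represents p n) \<and>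
    (\<forall>(f, C)\<in>S. pair_defect (f, C) \<le> s \<and> int (pdegree f) \<le> \<lfloor>s\<rfloor> \<and>
       (pdegree f = 0 \<longrightarrow> pair_defect (f, C) < s))"
proof -
  obtain S where S: "spans_below S s" using ex_spans_below by blast
  then have fin: "finite S" and adm: "\<forall>t\<in>S. admissible t" by (auto simp: spans_below_def)
  have "\<forall>t\<in>S. \<exists>F. finite F \<and> (\<forall>u\<in>F. truncated s u) \<and>
      (\<forall>N. eff_rep t N \<and> defect N < s \<longrightarrow> (\<exists>u\<in>F. eff_rep u N))"
    using ex_truncation adm by blast
  from bchoice[OF this] obtain F where
    F: "\<forall>t\<in>S. finite (F t) \<and> (\<forall>u\<in>F t. truncated s u) \<and>
      (\<forall>N. eff_rep t N \<and> defect N < s \<longrightarrow> (\<exists>u\<in>F t. eff_rep u N))" ..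
  define U where "U = (\<Union>t\<in>S. F t)"
  have U: "finite U" unfolding U_def using F fin by (intro finite_UN_I) simp_all
  have trunc: "truncated s u" if "u \<in> U" for u
    using that F unfolding U_def by (elim UN_E) simp
  have rep: "\<exists>u\<in>U. eff_rep u n" if "n \<in> B s" for n
  proof -
    have n: "leader n" "n > 0" "defect n < s" using that by (simp_all add: B_def leader_def)
    then have "rep_up_to_3 S n" using S unfolding spans_below_def by simp
    from leader_eff_rep[OF n(1) this adm] obtain t where t: "t \<in> S" "eff_rep t n" by blast
    with F n(3) obtain u where "u \<in> F t" "eff_rep u n" by meson
    with t(1) show ?thesis unfolding U_def by blast
  qed
  \<comment> \<open>The degree is an integer bounded by the defect, hence by the floor of
    \<open>s\<close>.\<close>
  have bound: "int (tdegree u) \<le> \<lfloor>s\<rfloor>" if "truncated s u" for u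
    using tdegree_le_tdefect[of u] that by (simp add: truncated_def le_floor_iff)
  have adm': "admissible u" if "truncated s u" for u
    using that by (simp add: truncated_def)
  show ?thesis
  proof (intro exI[of _ "(\<lambda>u. (poly_of u, cost u)) ` U"] conjI ballI)
    fix n assume "n \<in> B s"
    then obtain u where "u \<in> U" "eff_rep u n" using rep by blast
    then show "\<exists>p\<in>(\<lambda>u. (poly_of u, cost u)) ` U. efficiently_3_represents p n"
      using efficiently_3_represents_poly_of[OF adm'[OF trunc]] by blast
  next
    show "(\<lambda>u. (poly_of u, cost u)) ` U \<subseteq> low_defect_pairs"
      using poly_of_low_defect_pair[OF adm'[OF trunc]] by (rule image_subsetI)
  next
    fix p assume "p \<in> (\<lambda>u. (poly_of u, cost u)) ` U"
    then obtain u where u: "u \<in> U" "p = (poly_of u, cost u)" by blast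
    show "case p of (f, C) \<Rightarrow> pair_defect (f, C) \<le> s \<and> int (pdegree f) \<le> \<lfloor>s\<rfloor> \<and>
       (pdegree f = 0 \<longrightarrow> pair_defect (f, C) < s)"
      using trunc[OF u(1)] bound[OF trunc[OF u(1)]] adm'[OF trunc[OF u(1)]]
      by (simp add: u(2) pair_defect_poly_of pdegree_poly_of truncated_def)
  qed (rule finite_imageI[OF U])
qed

end
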